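(* Let $n\ge1$, $q\in[1,\infty]$, $s\in\mathbb{R}$, let $\mathbb{B}^n$ be the unit ball of $\mathbb{R}^n$, let $q_n=\frac{2(n+1)}{n-1}$ (with $q_1=\infty$), and $$s_{n,q}=\max\left\{n\left(\tfrac12-\tfrac1q\right),\ \tfrac{n+1}{4}-\tfrac{n-1}{2q}\right\}.$$ Consider, for all $f\in H^s(\mathbb{R}^n)$ and a constant $C_{n,q,s}$ independent of $f$, the estimates (i) $\|\sup_{0<t<1}|e^{\pm it\sqrt{-\Delta}}f|\|_{L^q(\mathbb{R}^n)}\le C_{n,q,s}\|f\|_{H^s(\mathbb{R}^n)}$; (ii) $\|\sup_{t\in\mathbb{R}}|e^{\pm it\sqrt{-\Delta}}f|\|_{L^q(\mathbb{R}^n)}\le C_{n,q,s}\|f\|_{H^s(\mathbb{R}^n)}$; (iii) $\|\sup_{0<t<1}|e^{\pm it\sqrt{-\Delta}}f|\|_{L^q(\mathbb{B}^n)}\le C_{n,q,s}\|f\|_{H^s(\mathbb{R}^n)}$; (iv) $\|\sup_{t\in\mathbb{R}}|e^{\pm it\sqrt{-\Delta}}f|\|_{L^q(\mathbb{B}^n)}\le C_{n,q,s}\|f\|_{H^s(\mathbb{R}^n)}$. If (i) holds, then $q\in[2,\infty]$ and $s\ge s_{n,q}$. If (ii) holds, then $q\in[q_n,\infty]$ and $s\ge n(\frac12-\frac1q)$. If (iii) or (iv) holds, then $s\ge\max\{1/2,s_{n,q}\}$.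
   Context: For $f$ on $\mathbb{R}^n$, $\widehat f(\xi)=\int f(x)e^{-2\pi i x\cdot\xi}dx$, and $$e^{\pm it\sqrt{-\Delta}}f(x)=\int_{\mathbb{R}^n}\widehat f(\xi)e^{2\pi i(x\cdot\xi\pm t|\xi|)}\,d\xi .$$ $H^s(\mathbb{R}^n)$ has norm $\|f\|_{H^s}=\big(\int(1+|\xi|)^{2s}|\widehat f(\xi)|^2d\xi\big)^{1/2}$. *)

theory Defs
  imports "HOL-Analysis.Analysis"
begin

definition fourier :: "(real^'n \<Rightarrow> complex) \<Rightarrow> real^'n \<Rightarrow> complex" where
  "fourier f \<xi> = (LINT x|lborel. f x * cis (- 2 * pi * (x \<bullet> \<xi>)))"

definition half_wave :: "real \<Rightarrow> (real^'n \<Rightarrow> complex) \<Rightarrow> real \<Rightarrow> real^'n \<Rightarrow> complex" where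
  "half_wave \<sigma> f t x = (LINT \<xi>|lborel. fourier f \<xi> * cis (2 * pi * (x \<bullet> \<xi> + \<sigma> * t * norm \<xi>)))"

definition Hs_norm :: "real \<Rightarrow> (real^'n \<Rightarrow> complex) \<Rightarrow> real" where
  "Hs_norm s f = sqrt (LINT \<xi>|lborel. (1 + norm \<xi>) powr (2 * s) * (cmod (fourier f \<xi>))\<^sup>2)"

text \<open>Test functions: f in L^1 with hat f in L^1 and ||f||_{H^s} finite; on this class
  f is in H^s and the propagator is given literally by the Fourier integral.\<close>
definition Hs_test :: "real \<Rightarrow> (real^'n \<Rightarrow> complex) \<Rightarrow> bool" where
  "Hs_test s f \<longleftrightarrow> integrable lborel f \<and> integrable lborel (fourier f) \<and>
     integrable lborel (\<lambda>\<xi>. (1 + norm \<xi>) powr (2 * s) * (cmod (fourier f \<xi>))\<^sup>2)"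

definition max_wave :: "real \<Rightarrow> real set \<Rightarrow> (real^'n \<Rightarrow> complex) \<Rightarrow> real^'n \<Rightarrow> ennreal" where
  "max_wave \<sigma> T f x = (SUP t\<in>T. ennreal (cmod (half_wave \<sigma> f t x)))"

definition ennpow :: "ennreal \<Rightarrow> real \<Rightarrow> ennreal" where
  "ennpow x p = (if x = top then top else ennreal (enn2real x powr p))"

definition Lq_norm :: "ereal \<Rightarrow> (real^'n) set \<Rightarrow> (real^'n \<Rightarrow> ennreal) \<Rightarrow> ennreal" where
  "Lq_norm q A F =
     (if q = \<infinity> then Inf {c. AE x in lborel. x \<in> A \<longrightarrow> F x \<le> c}
      else ennpow (\<integral>\<^sup>+ x. indicator A x * ennpow (F x) (real_of_ereal q) \<partial>lborel)
                  (1 / real_of_ereal q))"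

definition inv_exp :: "ereal \<Rightarrow> real" where
  "inv_exp q = (if q = \<infinity> then 0 else 1 / real_of_ereal q)"

definition s_crit :: "nat \<Rightarrow> ereal \<Rightarrow> real" where
  "s_crit n q = max (real n * (1/2 - inv_exp q)) ((real n + 1) / 4 - (real n - 1) / 2 * inv_exp q)"

definition q_crit :: "nat \<Rightarrow> ereal" where
  "q_crit n = (if n = 1 then \<infinity> else ereal (2 * (real n + 1) / (real n - 1)))"

definition max_estimate :: "real \<Rightarrow> ereal \<Rightarrow> real \<Rightarrow> real set \<Rightarrow> (real^'n) set \<Rightarrow> bool" where
  "max_estimate \<sigma> q s T A \<longleftrightarrow> (\<exists>C::real. \<forall>f::real^'n \<Rightarrow> complex. Hs_test s f \<longrightarrow>
      Lq_norm q A (max_wave \<sigma> T f) \<le> ennreal (C * Hs_norm s f))"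

end

theory Submission
  imports Defs "HOL-Probability.Levy"
begin

text \<open>
  All necessary conditions come from Knapp examples. Take \<open>f\<close> whose Fourier transform is a product of
  triangle functions supported in a box \<open>Q\<close>. If the phase \<open>x \<bullet> \<xi> + \<sigma> t |\<xi>|\<close> stays within \<open>1/6\<close> of zero
  on \<open>Q\<close> for each \<open>x \<in> E\<close> and some \<open>t = t(x) \<in> T\<close>, there is no cancellation, and the maximal function
  is \<open>\<gtrsim> |Q|\<close> on \<open>E\<close>; hence \<open>|Q|\<^sup>1\<^sup>/\<^sup>2 |E|\<^sup>1\<^sup>/\<^sup>q \<lesssim> sup (1 + |\<xi>|)\<^sup>s\<close>, the supremum being over \<open>Q\<close>.

  For a plate \<open>Q\<close> of length \<open>N\<close> and width \<open>\<rho>\<close> at distance \<open>N\<close> from the origin one takes \<open>E\<close> of length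
  \<open>\<tau> \<lesssim> N / \<rho>\<^sup>2\<close> and width \<open>1 / \<rho>\<close>. Letting \<open>R \<rightarrow> \<infinity>\<close>, the choices \<open>(N, \<rho>, \<tau>) = (R, R, 1/R)\<close>,
  \<open>(R, R\<^sup>1\<^sup>/\<^sup>2, 1)\<close> and \<open>(R, 1, 1)\<close> give the lower bounds on \<open>s\<close>, and \<open>(1, R\<^sup>-\<^sup>1\<^sup>/\<^sup>2, R)\<close> gives \<open>q \<ge> q\<^sub>n\<close>.
  The cube \<open>Q\<close> of side \<open>2/R\<close> at the origin, whose wave does not move in unit time, gives \<open>q \<ge> 2\<close>.
\<close>

subsection \<open>Products of triangles as Fourier transforms\<close>

lemma interval_integral_symmetric_tendsto:
  fixes f :: "real \<Rightarrow> 'a::{banach,second_countable_topology}"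
  assumes "integrable lborel f"
  shows "(\<lambda>n::nat. LBINT t=-real n..real n. f t) \<longlonglongrightarrow> (LINT t|lborel. f t)"
proof -
  have "(\<lambda>n::nat. LINT t|lborel. indicator {-real n<..<real n} t *\<^sub>R f t) \<longlonglongrightarrow> (LINT t|lborel. f t)"
  proof (rule integral_dominated_convergence[where w = "\<lambda>t. norm (f t)"])
    show "AE t in lborel. (\<lambda>n::nat. indicator {-real n<..<real n} t *\<^sub>R f t) \<longlonglongrightarrow> f t"
    proof (rule AE_I2)
      fix t :: real
      obtain m :: nat where "\<bar>t\<bar> < real m"
        using reals_Archimedean2 by blast
      have "\<forall>\<^sub>F n in sequentially. indicator {-real n<..<real n} t *\<^sub>R f t = f t"
        using eventually_ge_at_top[of m] by eventually_elim (use \<open>\<bar>t\<bar> < real m\<close> in \<open>auto simp: indicator_def\<close>)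
      then show "(\<lambda>n::nat. indicator {-real n<..<real n} t *\<^sub>R f t) \<longlonglongrightarrow> f t"
        by (rule tendsto_eventually)
    qed
  qed (use assms in \<open>auto split: split_indicator\<close>)
  then show ?thesis
    by (simp add: interval_lebesgue_integral_def set_lebesgue_integral_def)
qed

lemma (in real_distribution) Levy_Inversion_integrable:
  fixes a b :: real
  assumes "a \<le> b" "measure M {a} = 0" "measure M {b} = 0"
    and "integrable lborel (\<lambda>t. (iexp (-(t * a)) - iexp (-(t * b))) / (\<i> * t) * char M t)"
  shows "(CLINT t|lborel. (iexp (-(t * a)) - iexp (-(t * b))) / (\<i> * t) * char M t)
    = of_real (2 * pi * measure M {a<..b})" (is "?I = _")
proof -
  have "(\<lambda>n::nat. 1 / (2 * pi) *
      (CLBINT t=-real n..real n. (iexp (-(t * a)) - iexp (-(t * b))) / (\<i> * t) * char M t))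
      \<longlonglongrightarrow> 1 / (2 * pi) * ?I"
    by (intro tendsto_mult tendsto_const interval_integral_symmetric_tendsto assms(4))
  then have "1 / (2 * pi) * ?I = of_real (measure M {a<..b})"
    using LIMSEQ_unique Levy_Inversion[OF assms(1-3)] by fastforce
  then show ?thesis
    by (simp add: field_simps)
qed

lemma iexp_diff_uminus: "iexp t - iexp (- t) = 2 * \<i> * of_real (sin t)"
  by (simp add: complex_eq_iff Re_exp Im_exp)

lemma char_uniform_symmetric:
  assumes "t \<noteq> 0"
  shows "char (uniform_measure lborel {-1..1}) t = of_real (sin t / t)"
proof -
  have "uniform_measure lborel {-1..1::real} = density lborel (\<lambda>x. ennreal (indicator {-1..1} x / 2))"
    unfolding uniform_measure_def
    by (intro density_cong) (auto simp: divide_ennreal[symmetric] split: split_indicator)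
  then have "char (uniform_measure lborel {-1..1}) t =
      (CLINT x|lborel. (indicator {-1..1} x / 2) *\<^sub>R iexp (t * x))"
    by (simp add: char_def integral_density)
  also have "\<dots> = (CLINT x|lborel. indicator {-1..1} x *\<^sub>R (iexp (t * x) / 2))"
    by (intro Bochner_Integration.integral_cong) (auto split: split_indicator simp: scaleR_conv_of_real)
  also have "\<dots> = iexp (t * 1) / (2 * \<i> * t) - iexp (t * (-1)) / (2 * \<i> * t)"
  proof (rule integral_FTC_Icc)
    fix x :: real
    show "((\<lambda>x. iexp (t * x) / (2 * \<i> * t)) has_vector_derivative iexp (t * x) / 2) (at x within {-1..1})"
      using assms
      by (auto intro!: derivative_eq_intros has_vector_derivative_real_field simp: field_simps)
  qed (auto intro!: continuous_intros)
  also have "\<dots> = of_real (sin t / t)"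
    using assms iexp_diff_uminus[of t] by (simp add: diff_divide_distrib[symmetric])
  finally show ?thesis .
qed

lemma measure_uniform_symmetric_Ioc:
  fixes m :: real
  shows "measure (uniform_measure lborel {-1..1}) {m - 1<..m + 1} = max 0 (1 - \<bar>m\<bar> / 2)"
proof -
  have "measure lborel ({-1..1} \<inter> {m - 1<..m + 1}) = measure lborel {max (-1) (m - 1)..min 1 (m + 1)}"
  proof (rule measure_eq_AE)
    show "AE x in lborel. x \<in> {-1..1} \<inter> {m - 1<..m + 1} \<longleftrightarrow> x \<in> {max (-1) (m - 1)..min 1 (m + 1)}"
      using AE_lborel_singleton[of "m - 1"] by eventually_elim auto
  qed auto
  also have "\<dots> = max 0 (2 - \<bar>m\<bar>)"
    by (cases "\<bar>m\<bar> \<le> 2") auto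
  finally show ?thesis
    by (subst measure_uniform_measure) (auto simp: max_def field_simps)
qed

lemma integrable_sinc_square: "integrable lborel (\<lambda>x::real. (sin x / x)\<^sup>2)"
proof (rule Bochner_Integration.integrable_bound)
  show "integrable lborel (\<lambda>x::real. 2 * inverse (1 + x\<^sup>2))"
    using integrable_inverse_1_plus_square by (simp add: set_integrable_def)
  have "(sin x / x)\<^sup>2 \<le> 2 * inverse (1 + x\<^sup>2)" for x :: real
  proof (cases "x = 0")
    case False
    have "(sin x)\<^sup>2 * x\<^sup>2 \<le> 1 * x\<^sup>2"
      by (intro mult_right_mono) (simp_all add: abs_square_le_1)
    moreover have "(sin x)\<^sup>2 \<le> x\<^sup>2"
      using abs_sin_x_le_abs_x[of x] by (simp add: abs_le_square_iff)
    ultimately have "(sin x)\<^sup>2 * (1 + x\<^sup>2) \<le> 2 * x\<^sup>2"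
      by (simp add: algebra_simps)
    then show ?thesis
      using False by (simp add: power_divide divide_simps add_pos_nonneg)
  qed simp
  then show "AE x in lborel. norm ((sin x / x)\<^sup>2) \<le> norm (2 * inverse (1 + (x::real)\<^sup>2))"
    by simp
qed simp

text \<open>Levy inversion is applied to the uniform distribution on \<open>[-1, 1]\<close>; the interval \<open>(m - 1, m + 1]\<close>
  contributes a second factor \<open>2 sin t / t\<close>.\<close>

lemma fourier_sinc_square:
  fixes m :: real
  shows "(CLINT t|lborel. of_real ((sin t / t)\<^sup>2) * iexp (- (t * m))) = of_real (pi * max 0 (1 - \<bar>m\<bar> / 2))"
proof -
  define M where "M = uniform_measure lborel {-1..1::real}"
  interpret M: prob_space M
    unfolding M_def by (rule prob_space_uniform_measure) auto
  interpret M: real_distribution M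
    by unfold_locales (simp_all add: M_def)
  have atomless: "measure M {x} = 0" for x
    unfolding M_def by (subst measure_uniform_measure) (auto simp: Int_insert_right)
  let ?g = "\<lambda>t. of_real ((sin t / t)\<^sup>2) * iexp (- (t * m)) :: complex"
  have kernel_eq: "(iexp (-(t * (m - 1))) - iexp (-(t * (m + 1)))) / (\<i> * t) * char M t = 2 * ?g t" for t :: real
  proof (cases "t = 0")
    case False
    have "iexp (-(t * (m - 1))) - iexp (-(t * (m + 1))) = iexp (-(t * m)) * (iexp t - iexp (-t))"
      by (simp add: algebra_simps flip: exp_add)
    also have "iexp t - iexp (-t) = 2 * \<i> * of_real (sin t)"
      by (rule iexp_diff_uminus)
    finally show ?thesis
      using False by (simp add: M_def char_uniform_symmetric power2_eq_square)
  qed simp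
  have "integrable lborel ?g"
    by (rule Bochner_Integration.integrable_bound[OF integrable_sinc_square])
       (auto simp: norm_mult norm_power norm_divide power2_eq_square)
  then have "2 * (CLINT t|lborel. ?g t) = of_real (2 * pi * measure M {m - 1<..m + 1})"
    using M.Levy_Inversion_integrable[of "m - 1" "m + 1", unfolded kernel_eq] by (simp add: atomless)
  then show ?thesis
    by (simp add: M_def measure_uniform_symmetric_Ioc)
qed

definition triangle :: "real \<Rightarrow> real \<Rightarrow> real \<Rightarrow> real" where
  "triangle c L \<xi> = max 0 (1 - \<bar>\<xi> - c\<bar> / L)"

text \<open>At \<open>x = 0\<close> division by zero gives the value \<open>0\<close> instead of \<open>L\<close>; a null set does not matter here.\<close>

definition fejer :: "real \<Rightarrow> real \<Rightarrow> real \<Rightarrow> complex" where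
  "fejer c L x = of_real (L * (sin (pi * L * x) / (pi * L * x))\<^sup>2) * cis (2 * pi * c * x)"

lemma integrable_fejer:
  assumes "L > 0"
  shows "integrable lborel (fejer c L)"
proof (rule Bochner_Integration.integrable_bound)
  have "integrable lborel (\<lambda>x. (sin (0 + pi * L * x) / (0 + pi * L * x))\<^sup>2)"
    using assms by (intro lborel_integrable_real_affine integrable_sinc_square) auto
  then show "integrable lborel (\<lambda>x. L * (sin (pi * L * x) / (pi * L * x))\<^sup>2)"
    by simp
  show "fejer c L \<in> borel_measurable lborel"
    unfolding fejer_def[abs_def] cis_conv_exp by simp
  show "AE x in lborel. norm (fejer c L x) \<le> norm (L * (sin (pi * L * x) / (pi * L * x))\<^sup>2)"
    by (simp add: fejer_def norm_mult del: of_real_mult of_real_power of_real_divide)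
qed

lemma fourier_fejer:
  assumes "L > 0"
  shows "(LINT x|lborel. fejer c L x * cis (- 2 * pi * (x * \<xi>))) = of_real (triangle c L \<xi>)"
proof -
  define m where "m = 2 * (\<xi> - c) / L"
  let ?g = "\<lambda>t. of_real ((sin t / t)\<^sup>2) * iexp (- (t * m)) :: complex"
  have rescale: "fejer c L x * cis (- 2 * pi * (x * \<xi>)) = of_real L * ?g (0 + pi * L * x)" for x
  proof -
    have "cis (2 * pi * c * x) * cis (- 2 * pi * (x * \<xi>)) = iexp (- (pi * L * x * m))"
      using assms unfolding cis_mult cis_conv_exp[symmetric] m_def
      by (intro arg_cong[where f = cis]) (simp add: field_simps)
    then show ?thesis
      by (simp add: fejer_def mult_ac)
  qed
  have "of_real (pi * max 0 (1 - \<bar>m\<bar> / 2)) = (LINT t|lborel. ?g t)"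
    by (rule fourier_sinc_square[symmetric])
  also have "\<dots> = \<bar>pi * L\<bar> *\<^sub>R (LINT x|lborel. ?g (0 + pi * L * x))"
    using assms by (intro lborel_integral_real_affine) auto
  also have "\<dots> = of_real pi * (LINT x|lborel. of_real L * ?g (0 + pi * L * x))"
    unfolding integral_mult_right_zero using assms by (simp add: scaleR_conv_of_real)
  finally have "of_real (max 0 (1 - \<bar>m\<bar> / 2)) = (LINT x|lborel. of_real L * ?g (0 + pi * L * x))"
    by simp
  moreover have "\<bar>m\<bar> / 2 = \<bar>\<xi> - c\<bar> / L"
    using assms unfolding m_def abs_divide abs_mult by simp
  ultimately show ?thesis
    unfolding rescale triangle_def by simp
qed

lemma triangle_nonneg: "0 \<le> triangle c L \<xi>"
  by (simp add: triangle_def)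

lemma triangle_le_1: "L > 0 \<Longrightarrow> triangle c L \<xi> \<le> 1"
  by (simp add: triangle_def)

lemma triangle_nonzero_iff: "L > 0 \<Longrightarrow> triangle c L \<xi> \<noteq> 0 \<longleftrightarrow> \<bar>\<xi> - c\<bar> < L"
  by (auto simp: triangle_def max_def field_simps)

lemma integrable_triangle:
  assumes "L > 0"
  shows "integrable lborel (triangle c L)"
proof (rule Bochner_Integration.integrable_bound)
  show "integrable lborel (indicator {c - L..c + L} :: real \<Rightarrow> real)"
    by (rule integrable_real_indicator) (auto simp: emeasure_lborel_Icc_eq)
  have "\<bar>triangle c L x\<bar> \<le> indicator {c - L..c + L} x" for x
    using triangle_nonneg[of c L x] triangle_le_1[OF assms, of c x] triangle_nonzero_iff[OF assms, of c x]
    by (auto simp: indicator_def)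
  then show "AE x in lborel. norm (triangle c L x) \<le> norm (indicator {c - L..c + L} x :: real)"
    by auto
qed (simp add: triangle_def[abs_def])

lemma integral_triangle_ge:
  assumes "L > 0"
  shows "L / 2 \<le> (LINT \<xi>|lborel. triangle c L \<xi>)"
proof -
  have "(LINT \<xi>|lborel. indicator {c - L/2..c + L/2} \<xi> / 2) \<le> (LINT \<xi>|lborel. triangle c L \<xi>)"
  proof (rule integral_mono[OF _ integrable_triangle[OF assms]])
    show "integrable lborel (\<lambda>\<xi>. indicator {c - L/2..c + L/2} \<xi> / 2 :: real)"
      by (intro integrable_divide integrable_real_indicator) (auto simp: emeasure_lborel_Icc_eq)
    show "indicator {c - L/2..c + L/2} \<xi> / 2 \<le> triangle c L \<xi>" for \<xi>
      using assms by (auto simp: triangle_def indicator_def max_def abs_if field_simps)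
  qed
  then show ?thesis
    using assms by simp
qed

lemma
  fixes g :: "'a::euclidean_space \<Rightarrow> real \<Rightarrow> 'b::{real_normed_field,banach,second_countable_topology}"
  assumes integrable_factor: "\<And>b. b \<in> Basis \<Longrightarrow> integrable lborel (g b)"
  shows integrable_lborel_prod_Basis: "integrable lborel (\<lambda>x. \<Prod>b\<in>Basis. g b (x \<bullet> b))"
    and integral_lborel_prod_Basis:
      "(LINT x|lborel. (\<Prod>b\<in>Basis. g b (x \<bullet> b))) = (\<Prod>b\<in>Basis. LINT t|lborel. g b t)"
proof -
  interpret product_sigma_finite "\<lambda>_::'a. lborel :: real measure" by standard
  have [measurable]: "g b \<in> borel_measurable borel" if "b \<in> Basis" for b
    using borel_measurable_integrable[OF integrable_factor[OF that]] by simp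
  have measurable_sum: "(\<lambda>f. \<Sum>b\<in>Basis. f b *\<^sub>R b) \<in> measurable (Pi\<^sub>M Basis (\<lambda>_::'a. lborel)) borel"
    by simp
  have measurable_prod: "(\<lambda>x. \<Prod>b\<in>Basis. g b (x \<bullet> b)) \<in> borel_measurable borel"
    by measurable
  have coordinates: "(\<Prod>b\<in>Basis. g b ((\<Sum>b\<in>Basis. f b *\<^sub>R b) \<bullet> b)) = (\<Prod>b\<in>Basis. g b (f b))" for f
    by (intro prod.cong) (auto simp: inner_sum_left_Basis)
  show "integrable lborel (\<lambda>x. \<Prod>b\<in>Basis. g b (x \<bullet> b))"
    by (subst lborel_eq, subst integrable_distr_eq[OF measurable_sum measurable_prod])
       (simp add: coordinates product_integrable_prod integrable_factor)
  show "(LINT x|lborel. (\<Prod>b\<in>Basis. g b (x \<bullet> b))) = (\<Prod>b\<in>Basis. LINT t|lborel. g b t)"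
    by (subst lborel_eq, subst integral_distr[OF measurable_sum measurable_prod])
       (simp add: coordinates product_integral_prod integrable_factor)
qed

lemma cis_sum: "finite A \<Longrightarrow> cis (\<Sum>a\<in>A. f a) = (\<Prod>a\<in>A. cis (f a))"
  by (induction A rule: finite_induct) (auto simp: cis_mult[symmetric])

definition box_fejer :: "'a::euclidean_space \<Rightarrow> 'a \<Rightarrow> 'a \<Rightarrow> complex" where
  "box_fejer c L x = (\<Prod>b\<in>Basis. fejer (c \<bullet> b) (L \<bullet> b) (x \<bullet> b))"

definition box_triangle :: "'a::euclidean_space \<Rightarrow> 'a \<Rightarrow> 'a \<Rightarrow> real" where
  "box_triangle c L \<xi> = (\<Prod>b\<in>Basis. triangle (c \<bullet> b) (L \<bullet> b) (\<xi> \<bullet> b))"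

lemma fourier_box_fejer:
  fixes c L :: "real^'n"
  assumes L: "\<And>b. b \<in> Basis \<Longrightarrow> 0 < L \<bullet> b"
  shows "fourier (box_fejer c L) \<xi> = of_real (box_triangle c L \<xi>)"
proof -
  let ?factor = "\<lambda>b t. fejer (c \<bullet> b) (L \<bullet> b) t * cis (- 2 * pi * (t * (\<xi> \<bullet> b)))"
  have "box_fejer c L x * cis (- 2 * pi * (x \<bullet> \<xi>)) = (\<Prod>b\<in>Basis. ?factor b (x \<bullet> b))" for x
    unfolding box_fejer_def prod.distrib
    by (subst euclidean_inner) (simp add: sum_distrib_left flip: cis_sum sum_negf)
  then have "fourier (box_fejer c L) \<xi> = (LINT x|lborel. (\<Prod>b\<in>Basis. ?factor b (x \<bullet> b)))"
    unfolding fourier_def by simp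
  also have "\<dots> = (\<Prod>b\<in>Basis. LINT t|lborel. ?factor b t)"
  proof (rule integral_lborel_prod_Basis)
    fix b :: "real^'n" assume "b \<in> Basis"
    then have integrable: "integrable lborel (fejer (c \<bullet> b) (L \<bullet> b))"
      by (intro integrable_fejer L)
    note [measurable] = borel_measurable_integrable[OF integrable]
    show "integrable lborel (?factor b)"
      by (rule Bochner_Integration.integrable_bound[OF integrable]) (auto simp: norm_mult cis_conv_exp)
  qed
  also have "\<dots> = (\<Prod>b\<in>Basis. of_real (triangle (c \<bullet> b) (L \<bullet> b) (\<xi> \<bullet> b)))"
    by (intro prod.cong refl fourier_fejer L)
  finally show ?thesis
    by (simp add: box_triangle_def)
qed

lemma integrable_box_fejer:
  "(\<And>b. b \<in> Basis \<Longrightarrow> 0 < L \<bullet> b) \<Longrightarrow> integrable lborel (box_fejer c L)"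
  unfolding box_fejer_def[abs_def] by (intro integrable_lborel_prod_Basis integrable_fejer)

lemma integrable_box_triangle:
  "(\<And>b. b \<in> Basis \<Longrightarrow> 0 < L \<bullet> b) \<Longrightarrow> integrable lborel (box_triangle c L)"
  unfolding box_triangle_def[abs_def] by (intro integrable_lborel_prod_Basis integrable_triangle)

lemma integral_box_triangle_ge:
  fixes c L :: "'a::euclidean_space"
  assumes L: "\<And>b. b \<in> Basis \<Longrightarrow> 0 < L \<bullet> b"
  shows "measure lborel (cbox (c - L) (c + L)) / 4 ^ DIM('a) \<le> (LINT \<xi>|lborel. box_triangle c L \<xi>)"
proof -
  have "measure lborel (cbox (c - L) (c + L)) = (\<Prod>b\<in>Basis. 2 * (L \<bullet> b))"
    using L by (subst content_cbox) (auto simp: inner_add_left inner_diff_left less_imp_le intro!: prod.cong)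
  moreover have "(4::real) ^ DIM('a) = 2 ^ DIM('a) * 2 ^ DIM('a)"
    by (simp flip: power_mult_distrib)
  ultimately have "measure lborel (cbox (c - L) (c + L)) / 4 ^ DIM('a) = (\<Prod>b\<in>Basis. L \<bullet> b / 2)"
    by (simp add: prod_dividef prod.distrib)
  also have "\<dots> \<le> (\<Prod>b\<in>Basis. LINT t|lborel. triangle (c \<bullet> b) (L \<bullet> b) t)"
    using L by (intro prod_mono conjI integral_triangle_ge) (auto simp: less_imp_le)
  also have "\<dots> = (LINT \<xi>|lborel. box_triangle c L \<xi>)"
    unfolding box_triangle_def by (intro integral_lborel_prod_Basis[symmetric] integrable_triangle L)
  finally show ?thesis .
qed

subsection \<open>The Knapp inequality\<close>

lemma ennpow_mono:
  assumes "x \<le> y" "0 \<le> p"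
  shows "ennpow x p \<le> ennpow y p"
proof (cases "y = top")
  case False
  with assms have "enn2real x \<le> enn2real y"
    by (simp add: enn2real_mono top.not_eq_extremum)
  with False assms show ?thesis
    by (auto simp: ennpow_def top_unique intro!: ennreal_leI powr_mono2)
qed (simp add: ennpow_def)

lemma ennpow_ennreal: "0 \<le> m \<Longrightarrow> ennpow (ennreal m) p = ennreal (m powr p)"
  by (simp add: ennpow_def)

lemma Lq_norm_infinity_ge:
  assumes E: "E \<in> sets lborel" "E \<subseteq> A" "emeasure lborel E \<noteq> 0"
    and lower: "\<And>x. x \<in> E \<Longrightarrow> m \<le> F x"
  shows "m \<le> Lq_norm \<infinity> A F"
proof -
  have "m \<le> c" if bound: "AE x in lborel. x \<in> A \<longrightarrow> F x \<le> c" for c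
  proof (rule ccontr)
    assume "\<not> m \<le> c"
    have "AE x in lborel. x \<notin> E"
      using bound by eventually_elim (use E(2) lower \<open>\<not> m \<le> c\<close> in \<open>auto dest: order_trans\<close>)
    then show False
      using E by (subst (asm) AE_iff_measurable[of E]) auto
  qed
  then show ?thesis
    by (auto simp: Lq_norm_def intro!: Inf_greatest)
qed

lemma Lq_norm_real_ge:
  assumes p: "0 < p" and E: "E \<in> sets lborel" "E \<subseteq> A"
    and lower: "0 \<le> m" "\<And>x. x \<in> E \<Longrightarrow> ennreal m \<le> F x"
  shows "ennreal (m * measure lborel E powr (1 / p)) \<le> Lq_norm (ereal p) A F"
proof -
  have "ennreal (m powr p * measure lborel E) \<le> ennreal (m powr p) * emeasure lborel E"
    by (simp add: ennreal_mult measure_def mult_left_mono ennreal_enn2real_if)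
  also have "\<dots> = (\<integral>\<^sup>+ x. ennreal (m powr p) * indicator E x \<partial>lborel)"
    using E by (subst nn_integral_cmult_indicator) auto
  also have "\<dots> \<le> (\<integral>\<^sup>+ x. indicator A x * ennpow (F x) p \<partial>lborel)"
  proof (rule nn_integral_mono)
    fix x
    show "ennreal (m powr p) * indicator E x \<le> indicator A x * ennpow (F x) p"
      using E(2) ennpow_mono[of "ennreal m" "F x" p] lower p
      by (auto simp: ennpow_ennreal split: split_indicator)
  qed
  finally have "ennpow (ennreal (m powr p * measure lborel E)) (1 / p) \<le> Lq_norm (ereal p) A F"
    using p by (auto simp: Lq_norm_def intro!: ennpow_mono)
  moreover have "(m powr p * measure lborel E) powr (1 / p) = m * measure lborel E powr (1 / p)"
    using p lower by (simp add: powr_mult powr_powr)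
  ultimately show ?thesis
    by (simp add: ennpow_ennreal)
qed

lemma Lq_norm_ge:
  assumes q: "1 \<le> q" and E: "E \<in> sets lborel" "E \<subseteq> A"
    and lower: "0 \<le> m" "\<And>x. x \<in> E \<Longrightarrow> ennreal m \<le> F x"
  shows "ennreal (m * measure lborel E powr inv_exp q) \<le> Lq_norm q A F"
proof (cases q)
  case (real p)
  then show ?thesis
    using q Lq_norm_real_ge[OF _ E lower] by (simp add: inv_exp_def)
next
  case PInf
  show ?thesis
  proof (cases "measure lborel E = 0")
    case False
    then have "emeasure lborel E \<noteq> 0"
      by (auto simp: measure_def)
    then show ?thesis
      using False PInf Lq_norm_infinity_ge[OF E _ lower(2)] by (simp add: inv_exp_def)
  qed simp
qed (use q in auto)

lemma cmod_integral_cis_ge: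
  fixes g \<phi> :: "'a \<Rightarrow> real"
  assumes g: "integrable M g" "\<And>x. 0 \<le> g x" and \<phi>: "\<phi> \<in> borel_measurable M"
    and phase: "\<And>x. g x \<noteq> 0 \<Longrightarrow> \<bar>\<phi> x\<bar> \<le> pi / 3"
  shows "(LINT x|M. g x) / 2 \<le> cmod (LINT x|M. of_real (g x) * cis (\<phi> x))"
proof -
  note [measurable] = borel_measurable_integrable[OF g(1)] \<phi>
  have integrable: "integrable M (\<lambda>x. of_real (g x) * cis (\<phi> x))"
    by (rule Bochner_Integration.integrable_bound[OF g(1)]) (auto simp: norm_mult cis_conv_exp)
  have "g x / 2 \<le> Re (of_real (g x) * cis (\<phi> x))" for x
  proof (cases "g x = 0")
    case False
    then have "cos (pi / 3) \<le> cos \<bar>\<phi> x\<bar>"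
      using phase[of x] by (intro cos_monotone_0_pi_le) auto
    then have "g x * (1 / 2) \<le> g x * cos (\<phi> x)"
      using g(2) by (intro mult_left_mono) (auto simp: cos_60)
    then show ?thesis
      by simp
  qed simp
  then have "(LINT x|M. g x / 2) \<le> (LINT x|M. Re (of_real (g x) * cis (\<phi> x)))"
    by (intro integral_mono integrable_Re integrable integrable_divide g(1))
  also have "\<dots> = Re (LINT x|M. of_real (g x) * cis (\<phi> x))"
    by (rule integral_Re[OF integrable])
  also have "\<dots> \<le> cmod (LINT x|M. of_real (g x) * cis (\<phi> x))"
    by (rule complex_Re_le_cmod)
  finally show ?thesis
    by simp
qed

definition coherent :: "real \<Rightarrow> real set \<Rightarrow> 'a::euclidean_space set \<Rightarrow> 'a set \<Rightarrow> bool" where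
  "coherent \<sigma> T Q E \<longleftrightarrow> (\<forall>x\<in>E. \<exists>t\<in>T. \<forall>\<xi>\<in>Q. \<bar>x \<bullet> \<xi> + \<sigma> * t * norm \<xi>\<bar> \<le> 1 / 6)"

locale fourier_bump =
  fixes f :: "real^'n \<Rightarrow> complex" and g :: "real^'n \<Rightarrow> real" and Q :: "(real^'n) set"
  assumes integrable_bump: "integrable lborel f"
    and integrable_transform: "integrable lborel g"
    and fourier_eq: "fourier f \<xi> = of_real (g \<xi>)"
    and transform_nonneg: "0 \<le> g \<xi>"
    and transform_le_1: "g \<xi> \<le> 1"
    and transform_support: "g \<xi> \<noteq> 0 \<Longrightarrow> \<xi> \<in> Q"
begin

lemma max_wave_ge:
  assumes "coherent \<sigma> T Q E" "x \<in> E"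
  shows "ennreal ((LINT \<xi>|lborel. g \<xi>) / 2) \<le> max_wave \<sigma> T f x"
proof -
  obtain t where t: "t \<in> T" and phase: "\<And>\<xi>. \<xi> \<in> Q \<Longrightarrow> \<bar>x \<bullet> \<xi> + \<sigma> * t * norm \<xi>\<bar> \<le> 1 / 6"
    using assms unfolding coherent_def by blast
  have "(LINT \<xi>|lborel. g \<xi>) / 2 \<le> cmod (half_wave \<sigma> f t x)"
    unfolding half_wave_def fourier_eq
  proof (rule cmod_integral_cis_ge[OF integrable_transform transform_nonneg])
    show "\<bar>2 * pi * (x \<bullet> \<xi> + \<sigma> * t * norm \<xi>)\<bar> \<le> pi / 3" if "g \<xi> \<noteq> 0" for \<xi>
      using phase[OF transform_support[OF that]] by (simp add: abs_mult)
  qed simp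
  also have "ennreal (cmod (half_wave \<sigma> f t x)) \<le> max_wave \<sigma> T f x"
    unfolding max_wave_def by (rule SUP_upper[OF t])
  finally show ?thesis
    by (simp add: ennreal_leI)
qed

context
  fixes s K :: real
  assumes weight: "\<And>\<xi>. \<xi> \<in> Q \<Longrightarrow> (1 + norm \<xi>) powr s \<le> K"
begin

lemma weighted_transform_le:
  "(1 + norm \<xi>) powr (2 * s) * (cmod (fourier f \<xi>))\<^sup>2 \<le> K\<^sup>2 * g \<xi>"
proof (cases "g \<xi> = 0")
  case False
  then have "((1 + norm \<xi>) powr s)\<^sup>2 \<le> K\<^sup>2"
    by (intro power_mono weight transform_support) auto
  moreover have "(1 + norm \<xi>) powr (2 * s) = ((1 + norm \<xi>) powr s)\<^sup>2"
    by (simp add: power2_eq_square flip: powr_add)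
  moreover have "(g \<xi>)\<^sup>2 \<le> g \<xi>"
    using transform_nonneg transform_le_1 by (simp add: power2_eq_square mult_left_le)
  ultimately show ?thesis
    by (auto simp: fourier_eq intro!: mult_mono)
qed (simp add: fourier_eq)

lemma integrable_weighted_transform:
  "integrable lborel (\<lambda>\<xi>. (1 + norm \<xi>) powr (2 * s) * (cmod (fourier f \<xi>))\<^sup>2)"
proof (rule Bochner_Integration.integrable_bound)
  note [measurable] = borel_measurable_integrable[OF integrable_transform]
  show "integrable lborel (\<lambda>\<xi>. K\<^sup>2 * g \<xi>)"
    by (intro integrable_mult_right integrable_transform)
  show "(\<lambda>\<xi>. (1 + norm \<xi>) powr (2 * s) * (cmod (fourier f \<xi>))\<^sup>2) \<in> borel_measurable lborel"
    by (simp add: fourier_eq)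
  show "AE \<xi> in lborel. norm ((1 + norm \<xi>) powr (2 * s) * (cmod (fourier f \<xi>))\<^sup>2) \<le> norm (K\<^sup>2 * g \<xi>)"
    using order_trans[OF weighted_transform_le abs_ge_self] by (simp add: abs_mult)
qed

lemma Hs_test_bump: "Hs_test s f"
  using integrable_bump integrable_transform integrable_weighted_transform
  by (simp add: Hs_test_def fourier_eq[THEN ext])

lemma Hs_norm_bump_le:
  assumes "0 \<le> K"
  shows "Hs_norm s f \<le> K * sqrt (LINT \<xi>|lborel. g \<xi>)"
proof -
  have "(LINT \<xi>|lborel. (1 + norm \<xi>) powr (2 * s) * (cmod (fourier f \<xi>))\<^sup>2) \<le> (LINT \<xi>|lborel. K\<^sup>2 * g \<xi>)"
    using integrable_weighted_transform weighted_transform_le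
    by (intro integral_mono integrable_mult_right integrable_transform)
  then have "Hs_norm s f \<le> sqrt (K\<^sup>2 * (LINT \<xi>|lborel. g \<xi>))"
    by (simp add: Hs_norm_def)
  then show ?thesis
    using assms by (simp add: real_sqrt_mult)
qed

end

lemma sqrt_integral_transform_le:
  assumes q: "1 \<le> q"
    and estimate: "Hs_test s f \<Longrightarrow> Lq_norm q A (max_wave \<sigma> T f) \<le> ennreal (C * Hs_norm s f)" "0 \<le> C"
    and E: "E \<in> sets lborel" "E \<subseteq> A" "coherent \<sigma> T Q E"
    and weight: "\<And>\<xi>. \<xi> \<in> Q \<Longrightarrow> (1 + norm \<xi>) powr s \<le> K" "0 \<le> K"
  shows "sqrt (LINT \<xi>|lborel. g \<xi>) * measure lborel E powr inv_exp q \<le> 2 * C * K"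
proof -
  define P where "P = (LINT \<xi>|lborel. g \<xi>)"
  define W where "W = measure lborel E powr inv_exp q"
  have P: "0 \<le> P"
    unfolding P_def by (simp add: transform_nonneg)
  have "ennreal (P / 2 * W) \<le> Lq_norm q A (max_wave \<sigma> T f)"
    unfolding W_def using P E max_wave_ge by (intro Lq_norm_ge q) (auto simp: P_def)
  also have "\<dots> \<le> ennreal (C * Hs_norm s f)"
    by (rule estimate(1)[OF Hs_test_bump[OF weight(1)]])
  also have "\<dots> \<le> ennreal (C * (K * sqrt P))"
    unfolding P_def by (intro ennreal_leI mult_left_mono Hs_norm_bump_le weight estimate)
  finally have "P * W \<le> 2 * C * K * sqrt P"
    using P weight estimate by (simp add: ennreal_le_iff mult_ac)
  moreover have "P * W = sqrt P * (sqrt P * W)"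
    using P by (simp add: mult.assoc[symmetric])
  ultimately have "sqrt P * (sqrt P * W) \<le> sqrt P * (2 * C * K)"
    by (simp add: mult.commute)
  then show ?thesis
    using P estimate weight by (cases "P = 0") (auto simp: P_def W_def)
qed

end

lemma fourier_bump_box:
  fixes c L :: "real^'n"
  assumes L: "\<And>b. b \<in> Basis \<Longrightarrow> 0 < L \<bullet> b"
  shows "fourier_bump (box_fejer c L) (box_triangle c L) (cbox (c - L) (c + L))"
proof
  show "0 \<le> box_triangle c L \<xi>" "box_triangle c L \<xi> \<le> 1" for \<xi>
    using L by (auto simp: box_triangle_def triangle_nonneg triangle_le_1 intro!: prod_nonneg prod_le_1)
  show "\<xi> \<in> cbox (c - L) (c + L)" if "box_triangle c L \<xi> \<noteq> 0" for \<xi>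
    using that L
    by (force simp: box_triangle_def triangle_nonzero_iff mem_box inner_diff_left inner_add_left abs_less_iff)
qed (use L in \<open>simp_all add: integrable_box_fejer integrable_box_triangle fourier_box_fejer\<close>)

lemma max_estimateE:
  fixes A :: "(real^'n) set"
  assumes "max_estimate \<sigma> q s T A"
  obtains C where "0 \<le> C"
    "\<And>f::real^'n \<Rightarrow> complex. Hs_test s f \<Longrightarrow> Lq_norm q A (max_wave \<sigma> T f) \<le> ennreal (C * Hs_norm s f)"
proof -
  obtain C where "\<And>f::real^'n \<Rightarrow> complex. Hs_test s f \<Longrightarrow> Lq_norm q A (max_wave \<sigma> T f) \<le> ennreal (C * Hs_norm s f)"
    using assms unfolding max_estimate_def by auto
  moreover have "ennreal (C * Hs_norm s f) \<le> ennreal (\<bar>C\<bar> * Hs_norm s f)" for f :: "real^'n \<Rightarrow> complex"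
    by (intro ennreal_leI mult_right_mono) (auto simp: Hs_norm_def)
  ultimately show thesis
    by (intro that[of "\<bar>C\<bar>"]) (auto intro: order_trans)
qed

proposition knapp_inequality:
  fixes A E :: "(real^'n) set" and a b :: "real^'n"
  assumes q: "1 \<le> q"
    and estimate: "\<And>f. Hs_test s f \<Longrightarrow> Lq_norm q A (max_wave \<sigma> T f) \<le> ennreal (C * Hs_norm s f)" "0 \<le> C"
    and E: "E \<in> sets lborel" "E \<subseteq> A" "coherent \<sigma> T (cbox a b) E"
    and weight: "\<And>\<xi>. \<xi> \<in> cbox a b \<Longrightarrow> (1 + norm \<xi>) powr s \<le> K" "0 \<le> K"
  shows "sqrt (measure lborel (cbox a b)) * measure lborel E powr inv_exp q \<le> 2 ^ CARD('n) * (2 * C * K)"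
    (is "sqrt ?V * ?W \<le> _")
proof (cases "?V = 0")
  case False
  define c where "c = (1 / 2) *\<^sub>R (a + b)"
  define L where "L = (1 / 2) *\<^sub>R (b - a)"
  have box_eq: "cbox a b = cbox (c - L) (c + L)"
    by (simp add: c_def L_def flip: scaleR_diff_right scaleR_add_right scaleR_2)
  have L: "0 < L \<bullet> i" if "i \<in> Basis" for i
    using False that content_pos_lt_eq[of a b] zero_less_measure_iff[of lborel "cbox a b"]
    by (auto simp: L_def inner_diff_left)
  interpret fourier_bump "box_fejer c L" "box_triangle c L" "cbox a b"
    unfolding box_eq by (rule fourier_bump_box[OF L])
  have "sqrt ?V = 2 ^ CARD('n) * sqrt (?V / 4 ^ CARD('n))"
    by (simp add: real_sqrt_divide real_sqrt_power)
  also have "\<dots> \<le> 2 ^ CARD('n) * sqrt (LINT \<xi>|lborel. box_triangle c L \<xi>)"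
    using integral_box_triangle_ge[OF L, of c] by (simp add: box_eq)
  finally have "sqrt ?V * ?W \<le> 2 ^ CARD('n) * (sqrt (LINT \<xi>|lborel. box_triangle c L \<xi>) * ?W)"
    by (simp add: mult_right_mono flip: mult.assoc)
  also have "\<dots> \<le> 2 ^ CARD('n) * (2 * C * K)"
    by (intro mult_left_mono sqrt_integral_transform_le[OF q estimate E weight]) auto
  finally show ?thesis .
qed (use weight estimate in simp)

lemma powr_le_imp_exponent_le:
  fixes \<alpha> \<beta> C :: real
  assumes growth: "\<And>R. 1 \<le> R \<Longrightarrow> R powr \<alpha> \<le> C * R powr \<beta>"
  shows "\<alpha> \<le> \<beta>"
proof (rule ccontr)
  assume "\<not> \<alpha> \<le> \<beta>"
  then have gap: "\<alpha> - \<beta> > 0"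
    by simp
  define R where "R = (\<bar>C\<bar> + 1) powr (1 / (\<alpha> - \<beta>))"
  have R: "1 \<le> R"
    unfolding R_def using gap by (intro ge_one_powr_ge_zero) auto
  then have "R powr (\<alpha> - \<beta>) \<le> C"
    using growth[OF R] by (simp add: powr_diff field_simps)
  moreover have "R powr (\<alpha> - \<beta>) = \<bar>C\<bar> + 1"
    unfolding R_def using gap by (simp add: powr_powr)
  ultimately show False
    by simp
qed

lemma powr_le_of_scaled_bounds:
  fixes l u N y s :: real
  assumes "0 < l" "0 < N" "l * N \<le> y" "y \<le> u * N"
  shows "y powr s \<le> (l powr s + u powr s) * N powr s"
proof -
  have "0 < y"
    using assms(1-3) mult_pos_pos[of l N] by linarith
  have "y powr s \<le> (l * N) powr s + (u * N) powr s"
  proof (cases "0 \<le> s")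
    case True
    then have "y powr s \<le> (u * N) powr s"
      using \<open>0 < y\<close> assms by (intro powr_mono2) auto
    then show ?thesis
      by (simp add: add_increasing)
  next
    case False
    then have "y powr s \<le> (l * N) powr s"
      using assms by (intro powr_mono2') auto
    then show ?thesis
      by (simp add: add_increasing2)
  qed
  also have "\<dots> = (l powr s + u powr s) * N powr s"
    using assms \<open>0 < y\<close> zero_less_mult_pos2[of u N] by (simp add: powr_mult algebra_simps)
  finally show ?thesis .
qed

lemma max_estimate_exponent_le:
  fixes A :: "(real^'n) set" and Q E :: "real \<Rightarrow> (real^'n) set" and \<alpha> \<beta> \<gamma> v w K :: real
  assumes "max_estimate \<sigma> q s T A" "1 \<le> q" "0 < v" "0 < w" "0 \<le> K"
    and box: "\<And>R. \<exists>a b. Q R = cbox a b"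
    and E: "\<And>R. 1 \<le> R \<Longrightarrow> E R \<in> sets lborel" "\<And>R. 1 \<le> R \<Longrightarrow> E R \<subseteq> A"
    and coherent: "\<And>R. 1 \<le> R \<Longrightarrow> coherent \<sigma> T (Q R) (E R)"
    and measure_Q: "\<And>R. 1 \<le> R \<Longrightarrow> measure lborel (Q R) = v * R powr \<alpha>"
    and measure_E: "\<And>R. 1 \<le> R \<Longrightarrow> measure lborel (E R) = w * R powr \<beta>"
    and weight: "\<And>R \<xi>. 1 \<le> R \<Longrightarrow> \<xi> \<in> Q R \<Longrightarrow> (1 + norm \<xi>) powr s \<le> K * R powr \<gamma>"
  shows "\<alpha> / 2 + \<beta> * inv_exp q \<le> \<gamma>"
proof -
  obtain C where estimate: "0 \<le> C"
    "\<And>f::real^'n \<Rightarrow> complex. Hs_test s f \<Longrightarrow> Lq_norm q A (max_wave \<sigma> T f) \<le> ennreal (C * Hs_norm s f)"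
    using assms(1) by (rule max_estimateE) (rule that)
  define B where "B = sqrt v * w powr inv_exp q"
  have "0 < B"
    using assms(3,4) by (simp add: B_def)
  show ?thesis
  proof (rule powr_le_imp_exponent_le)
    fix R :: real assume R: "1 \<le> R"
    have "sqrt (v * R powr \<alpha>) * (w * R powr \<beta>) powr inv_exp q = B * R powr (\<alpha> / 2 + \<beta> * inv_exp q)"
      using R assms(3,4)
      by (simp add: B_def real_sqrt_mult powr_mult powr_powr powr_add flip: powr_half_sqrt)
    moreover have "sqrt (measure lborel (Q R)) * measure lborel (E R) powr inv_exp q
        \<le> 2 ^ CARD('n) * (2 * C * (K * R powr \<gamma>))"
    proof -
      obtain a b where "Q R = cbox a b"
        using box by blast
      then show ?thesis
        using knapp_inequality[OF assms(2) estimate(2,1) E[OF R], of a b "K * R powr \<gamma>"]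
          coherent[OF R] weight[OF R] assms(5) by simp
    qed
    ultimately show "R powr (\<alpha> / 2 + \<beta> * inv_exp q) \<le> 2 ^ CARD('n) * (2 * C * K) / B * R powr \<gamma>"
      using \<open>0 < B\<close> by (simp add: measure_Q[OF R] measure_E[OF R] field_simps)
  qed
qed

subsection \<open>Plates\<close>

definition plate :: "'a::euclidean_space \<Rightarrow> real \<Rightarrow> real \<Rightarrow> real \<Rightarrow> 'a set" where
  "plate k m h r = {x. \<bar>x \<bullet> k - m\<bar> \<le> h \<and> (\<forall>b\<in>Basis - {k}. \<bar>x \<bullet> b\<bar> \<le> r)}"

definition frequency_plate :: "'a::euclidean_space \<Rightarrow> real \<Rightarrow> real \<Rightarrow> 'a set" where
  "frequency_plate k N \<rho> = plate k N (N / 2) \<rho>"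

text \<open>The offset \<open>- \<sigma> * \<tau> / 2\<close> makes \<open>t = - \<sigma> (x \<bullet> k)\<close>, the time at which the wave passes \<open>x\<close>, positive and
  less than \<open>\<tau>\<close>.\<close>

definition dual_plate :: "real \<Rightarrow> 'a::euclidean_space \<Rightarrow> real \<Rightarrow> real \<Rightarrow> 'a set" where
  "dual_plate \<sigma> k \<tau> \<rho> = plate k (- \<sigma> * \<tau> / 2) (\<tau> / 4) (1 / (12 * real DIM('a) * \<rho>))"

context
  fixes k :: "'a::euclidean_space"
  assumes k: "k \<in> Basis"
begin

lemma plate_eq_cbox:
  "plate k m h r =
    cbox (\<Sum>b\<in>Basis. (if b = k then m - h else - r) *\<^sub>R b) (\<Sum>b\<in>Basis. (if b = k then m + h else r) *\<^sub>R b)"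
  (is "_ = cbox ?lo ?hi")
proof (rule set_eqI)
  fix x
  have "x \<in> plate k m h r \<longleftrightarrow> (\<forall>b\<in>Basis. (b = k \<longrightarrow> \<bar>x \<bullet> k - m\<bar> \<le> h) \<and> (b \<noteq> k \<longrightarrow> \<bar>x \<bullet> b\<bar> \<le> r))"
    using k by (auto simp: plate_def)
  also have "\<dots> \<longleftrightarrow> x \<in> cbox ?lo ?hi"
    unfolding mem_box by (intro ball_cong refl) (auto simp: inner_sum_left_Basis abs_le_iff)
  finally show "x \<in> plate k m h r \<longleftrightarrow> x \<in> cbox ?lo ?hi" .
qed

lemma plate_longitudinal_bounds:
  assumes "x \<in> plate k m h r"
  shows "m - h \<le> x \<bullet> k" "x \<bullet> k \<le> m + h"
  using assms by (auto simp: plate_def)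

lemma measure_plate:
  assumes "0 \<le> h" "0 \<le> r"
  shows "measure lborel (plate k m h r) = 2 * h * (2 * r) ^ (DIM('a) - 1)"
proof -
  have "measure lborel (plate k m h r) = (\<Prod>b\<in>Basis. if b = k then 2 * h else 2 * r)"
    unfolding plate_eq_cbox using assms
    by (subst content_cbox) (auto simp: inner_sum_left_Basis intro!: prod.cong)
  also have "\<dots> = 2 * h * (\<Prod>b\<in>Basis - {k}. 2 * r)"
    using k by (subst prod.remove[of _ k]) (auto intro!: prod.cong)
  finally show ?thesis
    using k by (simp add: card_Diff_singleton)
qed

lemma measure_plate_cube: "0 \<le> r \<Longrightarrow> measure lborel (plate k m r r) = (2 * r) ^ DIM('a)"
  by (simp add: measure_plate power_eq_if[of _ "DIM('a)"])

lemma abs_inner_minus_longitudinal_le: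
  assumes x: "x \<in> plate k m h r" and \<xi>: "\<xi> \<in> plate k m' h' r'" and "0 \<le> r" "0 \<le> r'"
  shows "\<bar>x \<bullet> \<xi> - (x \<bullet> k) * (\<xi> \<bullet> k)\<bar> \<le> real DIM('a) * (r * r')"
proof -
  have "x \<bullet> \<xi> = (x \<bullet> k) * (\<xi> \<bullet> k) + (\<Sum>b\<in>Basis - {k}. (x \<bullet> b) * (\<xi> \<bullet> b))"
    using k by (subst euclidean_inner) (simp add: sum.remove)
  then have "\<bar>x \<bullet> \<xi> - (x \<bullet> k) * (\<xi> \<bullet> k)\<bar> \<le> (\<Sum>b\<in>Basis - {k}. \<bar>x \<bullet> b\<bar> * \<bar>\<xi> \<bullet> b\<bar>)"
    by (simp add: sum_abs flip: abs_mult)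
  also have "\<dots> \<le> real (card (Basis - {k})) * (r * r')"
    using x \<xi> assms(3,4) by (intro sum_bounded_above mult_mono) (auto simp: plate_def)
  also have "\<dots> \<le> real DIM('a) * (r * r')"
    using assms(3,4) by (intro mult_right_mono of_nat_mono card_mono) auto
  finally show ?thesis .
qed

lemma norm_square_minus_longitudinal_le:
  assumes "\<xi> \<in> plate k m h r" "0 \<le> r"
  shows "(norm \<xi>)\<^sup>2 - (\<xi> \<bullet> k)\<^sup>2 \<le> real DIM('a) * r\<^sup>2"
  unfolding power2_norm_eq_inner unfolding power2_eq_square
  by (rule abs_le_D1[OF abs_inner_minus_longitudinal_le[OF assms(1,1,2,2)]])

lemma norm_plate_le:
  assumes "\<xi> \<in> plate k m h r" "0 \<le> r"
  shows "norm \<xi> \<le> \<bar>m\<bar> + h + real DIM('a) * r"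
proof -
  have "1 \<le> real DIM('a)"
    by (simp add: Suc_le_eq)
  then have "real DIM('a) * r\<^sup>2 \<le> (real DIM('a) * r)\<^sup>2"
    unfolding power_mult_distrib by (intro mult_right_mono self_le_power) auto
  moreover have "0 \<le> 2 * \<bar>\<xi> \<bullet> k\<bar> * (real DIM('a) * r)"
    using assms(2) by simp
  ultimately have "(norm \<xi>)\<^sup>2 \<le> (\<bar>\<xi> \<bullet> k\<bar> + real DIM('a) * r)\<^sup>2"
    using norm_square_minus_longitudinal_le[OF assms] unfolding power2_sum power2_abs by linarith
  then have "norm \<xi> \<le> \<bar>\<xi> \<bullet> k\<bar> + real DIM('a) * r"
    by (rule power2_le_imp_le) (simp add: assms(2))
  then show ?thesis
    using assms(1) by (auto simp: plate_def)
qed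

text \<open>This is the dispersion of a plate wave: \<open>norm \<xi> - \<xi> \<bullet> k = |\<xi>'|\<^sup>2 / (norm \<xi> + \<xi> \<bullet> k)\<close>,
  where \<open>\<xi>'\<close> is the component of \<open>\<xi>\<close> orthogonal to \<open>k\<close>.\<close>

lemma norm_minus_longitudinal_le:
  assumes "\<xi> \<in> frequency_plate k N \<rho>" "0 < N" "0 \<le> \<rho>"
  shows "norm \<xi> - \<xi> \<bullet> k \<le> real DIM('a) * \<rho>\<^sup>2 / N"
proof -
  have \<xi>: "\<xi> \<in> plate k N (N / 2) \<rho>"
    using assms(1) by (simp add: frequency_plate_def)
  have longitudinal: "\<xi> \<bullet> k \<le> norm \<xi>"
    using Basis_le_norm[OF k, of \<xi>] by simp
  have "N / 2 \<le> \<xi> \<bullet> k"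
    using plate_longitudinal_bounds(1)[OF \<xi>] by simp
  then have "(norm \<xi> - \<xi> \<bullet> k) * N \<le> (norm \<xi> - \<xi> \<bullet> k) * (norm \<xi> + \<xi> \<bullet> k)"
    using longitudinal by (intro mult_left_mono) linarith+
  also have "\<dots> \<le> real DIM('a) * \<rho>\<^sup>2"
    using norm_square_minus_longitudinal_le[OF \<xi> assms(3)] by (simp add: power2_eq_square algebra_simps)
  finally show ?thesis
    using assms(2) by (simp add: field_simps)
qed

lemma frequency_plate_weight_le:
  assumes "\<xi> \<in> frequency_plate k N \<rho>" "1 \<le> N" "0 \<le> \<rho>" "\<rho> \<le> N"
  shows "(1 + norm \<xi>) powr s \<le> ((1 / 2) powr s + (3 + real DIM('a)) powr s) * N powr s"
proof (rule powr_le_of_scaled_bounds)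
  have \<xi>: "\<xi> \<in> plate k N (N / 2) \<rho>"
    using assms(1) by (simp add: frequency_plate_def)
  show "1 / 2 * N \<le> 1 + norm \<xi>"
    using plate_longitudinal_bounds(1)[OF \<xi>] Basis_le_norm[OF k, of \<xi>] by simp
  have "norm \<xi> \<le> N + N / 2 + real DIM('a) * \<rho>"
    using norm_plate_le[OF \<xi> assms(3)] assms(2) by simp
  moreover have "real DIM('a) * \<rho> \<le> real DIM('a) * N"
    using assms(4) by (intro mult_left_mono) auto
  ultimately show "1 + norm \<xi> \<le> (3 + real DIM('a)) * N"
    using assms(2) unfolding distrib_right by linarith
qed (use assms(2) in auto)

lemma dual_plate_subset_ball:
  assumes "\<sigma> = 1 \<or> \<sigma> = -1" "0 < \<tau>" "0 < \<rho>"
  shows "dual_plate \<sigma> k \<tau> \<rho> \<subseteq> ball 0 (max \<tau> (1 / \<rho>))"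
proof
  fix x assume "x \<in> dual_plate \<sigma> k \<tau> \<rho>"
  then have "norm x \<le> \<bar>- \<sigma> * \<tau> / 2\<bar> + \<tau> / 4 + real DIM('a) * (1 / (12 * real DIM('a) * \<rho>))"
    unfolding dual_plate_def by (rule norm_plate_le) (use assms(3) in simp)
  also have "\<dots> = 3 / 4 * \<tau> + 1 / 12 * (1 / \<rho>)"
    using assms by auto
  also have "\<dots> < max \<tau> (1 / \<rho>)"
    using assms(2,3) zero_less_divide_1_iff[of \<rho>] unfolding less_max_iff_disj by linarith
  finally show "x \<in> ball 0 (max \<tau> (1 / \<rho>))"
    by simp
qed

lemma coherent_plate:
  assumes \<sigma>: "\<sigma> = 1 \<or> \<sigma> = -1" and "0 < N" "0 < \<rho>" "0 < \<tau>"
    and \<tau>: "12 * real DIM('a) * \<rho>\<^sup>2 * \<tau> \<le> N" and T: "{0<..<\<tau>} \<subseteq> T"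
  shows "coherent \<sigma> T (frequency_plate k N \<rho>) (dual_plate \<sigma> k \<tau> \<rho>)"
    (is "coherent _ _ ?Q ?E")
proof -
  have travel_time: "0 < - \<sigma> * (x \<bullet> k)" "- \<sigma> * (x \<bullet> k) < \<tau>" "\<bar>x \<bullet> k\<bar> \<le> \<tau>" if "x \<in> ?E" for x
    using plate_longitudinal_bounds[OF that[unfolded dual_plate_def]] \<sigma> assms(4) by auto
  have phase: "\<bar>x \<bullet> \<xi> + \<sigma> * (- \<sigma> * (x \<bullet> k)) * norm \<xi>\<bar> \<le> 1 / 6" if x: "x \<in> ?E" and \<xi>: "\<xi> \<in> ?Q" for x \<xi>
  proof -
    define D where "D = norm \<xi> - \<xi> \<bullet> k"
    have D: "0 \<le> D" "D \<le> real DIM('a) * \<rho>\<^sup>2 / N"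
      using norm_minus_longitudinal_le[OF \<xi>] Basis_le_norm[OF k, of \<xi>] assms(2,3) by (auto simp: D_def)
    have "\<bar>(x \<bullet> k) * D\<bar> \<le> \<tau> * (real DIM('a) * \<rho>\<^sup>2 / N)"
      unfolding abs_mult using travel_time(3)[OF x] D assms(4) by (intro mult_mono) auto
    also have "\<dots> \<le> 1 / 12"
      using \<tau> assms(2) by (simp add: field_simps)
    finally have "\<bar>(x \<bullet> k) * D\<bar> \<le> 1 / 12" .
    moreover have "\<bar>x \<bullet> \<xi> - (x \<bullet> k) * (\<xi> \<bullet> k)\<bar> \<le> 1 / 12"
      using abs_inner_minus_longitudinal_le[OF x[unfolded dual_plate_def] \<xi>[unfolded frequency_plate_def]]
        assms(3) by simp
    moreover have "x \<bullet> \<xi> + \<sigma> * (- \<sigma> * (x \<bullet> k)) * norm \<xi> = (x \<bullet> \<xi> - (x \<bullet> k) * (\<xi> \<bullet> k)) - (x \<bullet> k) * D"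
      using \<sigma> by (auto simp: D_def algebra_simps)
    ultimately show ?thesis
      by linarith
  qed
  show ?thesis
    unfolding coherent_def
  proof (intro ballI bexI)
    show "- \<sigma> * (x \<bullet> k) \<in> T" if "x \<in> ?E" for x
      using travel_time[OF that] T by auto
  qed (rule phase)
qed

lemma coherent_plate_powr:
  assumes "\<sigma> = 1 \<or> \<sigma> = -1" and R: "1 \<le> R" and exponents: "2 * b + d \<le> a" and T: "{0<..<R powr d} \<subseteq> T"
  shows "coherent \<sigma> T (frequency_plate k (R powr a) (R powr b))
    (dual_plate \<sigma> k (R powr d / (12 * real DIM('a))) (R powr b))"
proof (rule coherent_plate[OF assms(1)])
  have "(R powr b)\<^sup>2 * R powr d = R powr (2 * b + d)"
    by (simp only: powr_add power2_eq_square mult_2)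
  also have "\<dots> \<le> R powr a"
    using R exponents by (intro powr_mono) auto
  finally show "12 * real DIM('a) * (R powr b)\<^sup>2 * (R powr d / (12 * real DIM('a))) \<le> R powr a"
    by simp
  have "1 \<le> 12 * real DIM('a)"
    using DIM_ge_Suc0[where 'a = 'a] by linarith
  then have "R powr d / (12 * real DIM('a)) \<le> R powr d"
    by (simp add: divide_le_eq mult_le_cancel_left1)
  then show "{0<..<R powr d / (12 * real DIM('a))} \<subseteq> T"
    using T by force
qed (use R in auto)

end

lemma coherent_cball:
  assumes Q: "Q \<subseteq> cball 0 \<delta>" and E: "E \<subseteq> cball 0 \<epsilon>"
    and small: "\<epsilon> * \<delta> \<le> 1 / 12" "\<bar>\<sigma> * t\<bar> * \<delta> \<le> 1 / 12" and t: "t \<in> T"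
  shows "coherent \<sigma> T Q E"
  unfolding coherent_def
proof (intro ballI bexI)
  fix x \<xi> assume "x \<in> E" "\<xi> \<in> Q"
  then have x: "norm x \<le> \<epsilon>" and \<xi>: "norm \<xi> \<le> \<delta>"
    using Q E by auto
  have "\<bar>x \<bullet> \<xi>\<bar> \<le> norm x * norm \<xi>"
    by (rule Cauchy_Schwarz_ineq2)
  also have "\<dots> \<le> \<epsilon> * \<delta>"
    using x \<xi> order_trans[OF norm_ge_zero x] by (intro mult_mono) auto
  finally have "\<bar>x \<bullet> \<xi>\<bar> \<le> 1 / 12"
    using small(1) by simp
  moreover have "\<bar>\<sigma> * t * norm \<xi>\<bar> \<le> \<bar>\<sigma> * t\<bar> * \<delta>"
    unfolding abs_mult[of "\<sigma> * t"] using \<xi> by (intro mult_left_mono) auto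
  ultimately show "\<bar>x \<bullet> \<xi> + \<sigma> * t * norm \<xi>\<bar> \<le> 1 / 6"
    using small(2) by linarith
qed (rule t)

subsection \<open>Necessary exponents\<close>

proposition max_estimate_plate_exponents:
  fixes A :: "(real^'n) set" and a b d :: real
  defines "n \<equiv> real CARD('n)"
  assumes "max_estimate \<sigma> q s T A" "1 \<le> q" and \<sigma>: "\<sigma> = 1 \<or> \<sigma> = -1"
    and exponents: "0 \<le> a" "b \<le> a" "2 * b + d \<le> a"
    and T: "\<And>R. 1 \<le> R \<Longrightarrow> {0<..<R powr d} \<subseteq> T"
    and A: "\<And>R. 1 \<le> R \<Longrightarrow> ball 0 (max (R powr d) (R powr - b)) \<subseteq> A"
  shows "(a + b * (n - 1)) / 2 + (d - b * (n - 1)) * inv_exp q \<le> s * a"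
proof -
  obtain k :: "real^'n" where k: "k \<in> Basis"
    using nonempty_Basis by blast
  have n: "1 \<le> n"
    by (simp add: n_def Suc_le_eq)
  define \<tau> where "\<tau> R = R powr d / (12 * n)" for R
  define Q where "Q R = frequency_plate k (R powr a) (R powr b)" for R
  define E where "E R = dual_plate \<sigma> k (\<tau> R) (R powr b)" for R
  show ?thesis
  proof (rule max_estimate_exponent_le[where Q = Q and E = E])
    fix R :: real assume R: "1 \<le> R"
    have \<tau>: "0 < \<tau> R" "\<tau> R \<le> R powr d"
      using R n by (simp_all add: \<tau>_def divide_le_eq mult_le_cancel_left1)
    show "E R \<in> sets lborel"
      by (simp add: E_def dual_plate_def plate_eq_cbox[OF k])
    have "E R \<subseteq> ball 0 (max (\<tau> R) (1 / R powr b))"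
      unfolding E_def using R \<tau>(1) by (intro dual_plate_subset_ball[OF k \<sigma>]) auto
    also have "\<dots> \<subseteq> ball 0 (max (R powr d) (R powr - b))"
      using \<tau>(2) by (intro subset_ball) (auto simp: powr_minus_divide)
    finally show "E R \<subseteq> A"
      using A[OF R] by blast
    show "coherent \<sigma> T (Q R) (E R)"
      unfolding Q_def E_def \<tau>_def n_def
      using coherent_plate_powr[OF k \<sigma> R exponents(3) T[OF R]] by simp
    have transverse_power: "(R powr b) ^ (CARD('n) - Suc 0) = R powr (b * (n - 1))"
      using R by (subst powr_power) (auto simp: n_def of_nat_diff Suc_le_eq mult.commute)
    show "measure lborel (Q R) = 2 ^ (CARD('n) - 1) * R powr (a + b * (n - 1))"
      by (simp add: Q_def frequency_plate_def measure_plate[OF k] power_mult_distrib transverse_power powr_add)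
    show "measure lborel (E R) = 1 / (24 * n) * (1 / (6 * n)) ^ (CARD('n) - 1) * R powr (d - b * (n - 1))"
      using n \<tau>(1)
      by (simp add: E_def dual_plate_def n_def[symmetric] measure_plate[OF k] \<tau>_def powr_diff
          power_divide power_mult_distrib flip: transverse_power)
    show "(1 + norm \<xi>) powr s \<le> ((1 / 2) powr s + (3 + n) powr s) * R powr (s * a)" if "\<xi> \<in> Q R" for \<xi>
      using frequency_plate_weight_le[OF k that[unfolded Q_def], of s] R exponents
      by (simp add: n_def powr_powr powr_mono ge_one_powr_ge_zero mult.commute)
  qed (use assms n in \<open>auto simp: Q_def frequency_plate_def plate_eq_cbox[OF k]\<close>)
qed

lemma max_estimate_s_crit_le:
  fixes A :: "(real^'n) set"
  assumes estimate: "max_estimate \<sigma> q s T A" "1 \<le> q" "\<sigma> = 1 \<or> \<sigma> = -1"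
    and T: "{0<..<1} \<subseteq> T" and A: "ball 0 1 \<subseteq> A"
  shows "max (1/2) (s_crit CARD('n) q) \<le> s"
proof -
  define n where "n = real CARD('n)"
  have exponents: "(a + b * (n - 1)) / 2 + (d - b * (n - 1)) * inv_exp q \<le> s * a"
    if "0 \<le> a" "0 \<le> b" "b \<le> a" "d \<le> 0" "2 * b + d \<le> a" for a b d
    unfolding n_def
  proof (rule max_estimate_plate_exponents[OF estimate])
    fix R :: real assume "1 \<le> R"
    then have "R powr d \<le> 1" "R powr - b \<le> 1"
      using that powr_mono[of d 0 R] powr_mono[of "- b" 0 R] by auto
    then show "{0<..<R powr d} \<subseteq> T" "ball 0 (max (R powr d) (R powr - b)) \<subseteq> A"
      using T A by force+
  qed (use that in auto)
  have "1 / 2 \<le> s"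
    using exponents[of 1 0 0] by simp
  moreover have "n * (1/2 - inv_exp q) \<le> s"
    using exponents[of 1 1 "-1"] by (simp add: algebra_simps add_divide_distrib diff_divide_distrib)
  moreover have "(n + 1) / 4 - (n - 1) / 2 * inv_exp q \<le> s"
    using exponents[of 1 "1/2" 0] by (simp add: algebra_simps add_divide_distrib diff_divide_distrib)
  ultimately show ?thesis
    by (simp add: s_crit_def n_def)
qed

lemma max_estimate_UNIV_inv_exp_le:
  assumes estimate: "max_estimate \<sigma> q s T (UNIV :: (real^'n) set)" "1 \<le> q"
    and T: "t \<in> T" "\<bar>\<sigma> * t\<bar> \<le> 1 / (12 * (real CARD('n) + 1))"
  shows "inv_exp q \<le> 1 / 2"
proof -
  define n where "n = real CARD('n)"
  have n: "1 \<le> n"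
    by (simp add: n_def Suc_le_eq)
  obtain k :: "real^'n" where k: "k \<in> Basis"
    using nonempty_Basis by blast
  define \<epsilon> where "\<epsilon> = 1 / (12 * (n + 1))"
  define Q where "Q R = plate k 0 (1 / R) (1 / R)" for R
  define E :: "real \<Rightarrow> (real^'n) set" where "E R = cball 0 (\<epsilon> * R)" for R
  have "- n / 2 + n * inv_exp q \<le> 0"
  proof (rule max_estimate_exponent_le[OF estimate, where Q = Q and E = E])
    fix R :: real assume R: "1 \<le> R"
    have norm_Q: "norm \<xi> \<le> (n + 1) / R" if "\<xi> \<in> Q R" for \<xi>
      using norm_plate_le[OF k that[unfolded Q_def]] R by (simp add: n_def field_simps)
    show "coherent \<sigma> T (Q R) (E R)"
    proof (rule coherent_cball[where \<delta> = "(n + 1) / R" and \<epsilon> = "\<epsilon> * R" and t = t])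
      have "\<bar>\<sigma> * t\<bar> * ((n + 1) / R) \<le> 1 / (12 * (n + 1)) * (n + 1)"
        using T(2) R n by (intro mult_mono) (auto simp: n_def divide_le_eq mult_le_cancel_left1)
      also have "\<dots> = 1 / 12"
        using n by (simp add: field_simps)
      finally show "\<bar>\<sigma> * t\<bar> * ((n + 1) / R) \<le> 1 / 12" .
      show "\<epsilon> * R * ((n + 1) / R) \<le> 1 / 12"
        using R n by (simp add: \<epsilon>_def)
    qed (use norm_Q T in \<open>auto simp: E_def\<close>)
    show "measure lborel (Q R) = 2 ^ CARD('n) * R powr - n"
      using R by (simp add: Q_def measure_plate_cube[OF k] power_divide powr_minus_divide powr_realpow n_def)
    show "measure lborel (E R) = unit_ball_vol n * \<epsilon> ^ CARD('n) * R powr n"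
      using R n by (simp add: E_def content_cball \<epsilon>_def n_def powr_realpow flip: power_mult_distrib)
    show "(1 + norm \<xi>) powr s \<le> (1 powr s + (n + 2) powr s) * R powr 0" if "\<xi> \<in> Q R" for \<xi>
    proof -
      have "(n + 1) / R \<le> n + 1"
        using R n by (simp add: divide_le_eq mult_le_cancel_left1)
      then show ?thesis
        using powr_le_of_scaled_bounds[of 1 1 "1 + norm \<xi>" "n + 2" s] norm_Q[OF that] R by simp
    qed
  qed (use n in \<open>auto simp: Q_def E_def \<epsilon>_def plate_eq_cbox[OF k]\<close>)
  then show ?thesis
    using n by (simp add: field_simps)
qed

lemma two_le_iff_inv_exp_le:
  assumes "1 \<le> q"
  shows "2 \<le> q \<longleftrightarrow> inv_exp q \<le> 1 / 2"
  using assms by (cases q) (auto simp: inv_exp_def field_simps)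

lemma q_crit_le:
  assumes "1 \<le> n" "1 \<le> q" and "(real n + 1) * inv_exp q \<le> (real n - 1) / 2"
  shows "q_crit n \<le> q"
proof (cases q)
  case (real p)
  with assms have "1 \<le> p" "2 * (real n + 1) \<le> p * (real n - 1)"
    by (simp_all add: inv_exp_def field_simps)
  moreover from this have "n \<noteq> 1"
    by auto
  ultimately show ?thesis
    using real assms(1) by (simp add: q_crit_def divide_le_eq)
qed (use assms(2) in auto)

lemma max_estimate_global_q_crit_le:
  assumes "max_estimate \<sigma> q s UNIV (UNIV :: (real^'n) set)" "1 \<le> q" "\<sigma> = 1 \<or> \<sigma> = -1"
  shows "q_crit CARD('n) \<le> q"
proof (rule q_crit_le)
  show "(real CARD('n) + 1) * inv_exp q \<le> (real CARD('n) - 1) / 2"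
    using max_estimate_plate_exponents[OF assms, of 0 "- 1 / 2" 1] by (simp add: field_simps)
qed (use assms in \<open>auto simp: Suc_le_eq\<close>)

theorem theorem3p1:
  fixes \<sigma> :: real and q :: ereal and s :: real
  assumes "\<sigma> = 1 \<or> \<sigma> = -1"
    and "1 \<le> q"
  shows "(max_estimate \<sigma> q s {0<..<1} (UNIV :: (real^'n) set) \<longrightarrow>
            2 \<le> q \<and> s \<ge> s_crit CARD('n) q)
       \<and> (max_estimate \<sigma> q s UNIV (UNIV :: (real^'n) set) \<longrightarrow>
            q_crit CARD('n) \<le> q \<and> s \<ge> real CARD('n) * (1/2 - inv_exp q))
       \<and> ((max_estimate \<sigma> q s {0<..<1} (ball (0 :: real^'n) 1)
            \<or> max_estimate \<sigma> q s UNIV (ball (0 :: real^'n) 1)) \<longrightarrow>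
            s \<ge> max (1/2) (s_crit CARD('n) q))"
proof (intro conjI impI)
  note s_crit_le = max_estimate_s_crit_le[OF _ assms(2,1)]
  {
    assume estimate: "max_estimate \<sigma> q s {0<..<1} (UNIV :: (real^'n) set)"
    show "2 \<le> q"
      unfolding two_le_iff_inv_exp_le[OF assms(2)]
    proof (rule max_estimate_UNIV_inv_exp_le[OF estimate assms(2)])
      show "1 / (12 * (real CARD('n) + 1)) \<in> {0<..<1}"
        by (simp add: add_pos_pos)
    qed (use assms(1) in auto)
    show "s \<ge> s_crit CARD('n) q"
      using s_crit_le[OF estimate] by simp
  next
    assume estimate: "max_estimate \<sigma> q s UNIV (UNIV :: (real^'n) set)"
    show "q_crit CARD('n) \<le> q"
      by (rule max_estimate_global_q_crit_le[OF estimate assms(2,1)])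
    show "s \<ge> real CARD('n) * (1/2 - inv_exp q)"
      using s_crit_le[OF estimate] by (simp add: s_crit_def)
  next
    assume "max_estimate \<sigma> q s {0<..<1} (ball (0 :: real^'n) 1)
      \<or> max_estimate \<sigma> q s UNIV (ball (0 :: real^'n) 1)"
    then show "s \<ge> max (1/2) (s_crit CARD('n) q)"
      using s_crit_le by blast
  }
qed

end
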